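(* For every integer $d \geq 6$ there exists a Mani $d$-polytope that is not simplicial. That is, for every $d\ge 6$ there exists an illuminated $d$-polytope with exactly $M(d)=\min\{2d,\ d+1+\lceil 2\sqrt{d}\,\rceil\}$ vertices that has at least one facet that is not a simplex.
   Context: A $d$-polytope is a convex polytope that is full-dimensional in $\mathbb{R}^d$. For a $d$-polytope $P$, $f_0(P)$ denotes its number of vertices. An inner diagonal of $P$ is a segment connecting two vertices of $P$ that passes through the interior of $P$. The polytope $P$ is illuminated if every vertex of $P$ lies on an inner diagonal, i.e. is an endpoint of some inner diagonal. For $d\ge 1$ set $M(d) := \min\{2d,\ d+1+\lceil 2\sqrt{d}\,\rceil\}$; by a theorem of Mani this is the minimum number of vertices of an illuminated $d$-polytope. A Mani $d$-polytope is an illuminated $d$-polytope with exactly $M(d)$ vertices. A polytope is simplicial if all of its facets are simplices. *)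

theory Defs
  imports "HOL-Analysis.Analysis"
begin

definition d_polytope :: "'a::euclidean_space set \<Rightarrow> bool" where
  "d_polytope P \<longleftrightarrow> polytope P \<and> aff_dim P = int DIM('a)"

definition vertices :: "'a::euclidean_space set \<Rightarrow> 'a set" where
  "vertices P = {v. v extreme_point_of P}"

definition f0 :: "'a::euclidean_space set \<Rightarrow> nat" where
  "f0 P = card (vertices P)"

text \<open>The inner diagonal is represented by its two endpoints.\<close>

definition inner_diagonal :: "'a::euclidean_space set \<Rightarrow> 'a \<Rightarrow> 'a \<Rightarrow> bool" where
  "inner_diagonal P v w \<longleftrightarrow>
     v \<in> vertices P \<and> w \<in> vertices P \<and> v \<noteq> w \<and> closed_segment v w \<inter> interior P \<noteq> {}"

definition illuminated :: "'a::euclidean_space set \<Rightarrow> bool" where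
  "illuminated P \<longleftrightarrow> (\<forall>v \<in> vertices P. \<exists>w. inner_diagonal P v w)"

definition mani_number :: "nat \<Rightarrow> nat" where
  "mani_number d = min (2 * d) (d + 1 + nat \<lceil>2 * sqrt (real d)\<rceil>)"

definition mani_polytope :: "'a::euclidean_space set \<Rightarrow> bool" where
  "mani_polytope P \<longleftrightarrow> d_polytope P \<and> illuminated P \<and> f0 P = mani_number DIM('a)"

definition simplicial :: "'a::euclidean_space set \<Rightarrow> bool" where
  "simplicial P \<longleftrightarrow> (\<forall>F. F facet_of P \<longrightarrow> (\<exists>k. k simplex F))"

end

theory Submission
  imports Defs
begin

text \<open>
  The polytope is described by a Gale diagram, a configuration of \<open>n = d + 1 + k\<close> vectors \<open>g\<^sub>i\<close> in
  dimension \<open>k\<close> such that \<open>i \<mapsto> \<langle>y, g\<^sub>i\<rangle>\<close> ranges over the affine dependencies of the vertices.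
  All points are vertices if every open half-space contains at least two of the \<open>g\<^sub>i\<close>; two vertices
  span an inner diagonal if some \<open>y\<close> is negative on them and positive on all the others; and a
  positive dependency among at most \<open>k\<close> of the \<open>g\<^sub>i\<close> yields a face with more than \<open>d\<close> vertices.

  Let \<open>k = a + b\<close> with \<open>k = \<lceil>2 \<surd>d\<rceil>\<close> and \<open>a = \<lfloor>k / 2\<rfloor>\<close>, and let \<open>p\<^sub>0, \<dots>, p\<^sub>a\<close> be vectors with sum \<open>0\<close> spanning
  \<open>\<real>\<^sup>a\<close>. The configuration in \<open>\<real>\<^sup>a \<times> \<real>\<^sup>b\<close> has \<open>a + 1\<close> stars, star \<open>t\<close> being made of the leaves
  \<open>(p\<^sub>t, e\<^sub>j)\<close> and the hub \<open>(\<rho> p\<^sub>t, - (e\<^sub>0 + \<dots> + e\<^bsub>b-1\<^esub>))\<close> with \<open>\<rho> = a b - 1\<close>. Every leaf can be separated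
  together with its hub from everything else because \<open>\<rho>\<close> is large, whereas \<open>\<rho> < a b\<close> prevents a hub
  from being separated alone. This gives \<open>(a + 1) (b + 1)\<close> vectors, hence \<open>d = a b\<close>. The arguments
  use little more than the sum of the leaves of a star, so leaves may be merged to reach the other
  values of \<open>d\<close>, and three leaves may be replaced by their pairwise midpoints to obtain a
  non-simplicial facet.
\<close>

section \<open>Gale duality: from dependencies to points and to a polytope\<close>

text \<open>Weights live on indices because the points are not yet known to be distinct when this is
  applied; a repeated point has all its weight at one index.\<close>

lemma convex_hull_image_weights:
  fixes x :: "'i \<Rightarrow> 'a::real_vector"
  assumes "finite J" "y \<in> convex hull (x ` J)"
  obtains c where "\<forall>i\<in>J. 0 \<le> c i" "sum c J = 1" "(\<Sum>i\<in>J. c i *\<^sub>R x i) = y"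
proof -
  obtain K where K: "K \<subseteq> J" "inj_on x K" "x ` J = x ` K"
    using subset_image_inj[of "x ` J" x J] by auto
  have "finite (x ` J)" using assms(1) by simp
  then obtain u where u: "\<forall>z\<in>x ` J. 0 \<le> u z" "sum u (x ` J) = 1" "(\<Sum>z\<in>x ` J. u z *\<^sub>R z) = y"
    using assms(2) by (auto simp: convex_hull_finite)
  define c where "c i = (if i \<in> K then u (x i) else 0)" for i
  have "sum c J = sum c K"
    by (rule sum.mono_neutral_right) (use assms(1) K(1) in \<open>auto simp: c_def\<close>)
  moreover have "(\<Sum>i\<in>J. c i *\<^sub>R x i) = (\<Sum>i\<in>K. c i *\<^sub>R x i)"
    by (rule sum.mono_neutral_right) (use assms(1) K(1) in \<open>auto simp: c_def\<close>)
  ultimately have "sum c J = 1" "(\<Sum>i\<in>J. c i *\<^sub>R x i) = y"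
    using u(2,3) by (simp_all add: K(3) sum.reindex[OF K(2)] c_def)
  moreover have "\<forall>i\<in>J. 0 \<le> c i" using u(1) by (simp add: c_def)
  ultimately show thesis using that by blast
qed

text \<open>
  \<open>U\<close> is a linear space of functions, of which only the values on \<open>I\<close> matter; restriction to \<open>B\<close> is
  a linear isomorphism, so its dimension is \<open>card B\<close>.
\<close>

locale dependency_space =
  fixes U :: "('i \<Rightarrow> real) set" and I B :: "'i set"
  assumes fin: "finite I" and BI: "B \<subseteq> I"
    and lin: "\<And>f g c. f \<in> U \<Longrightarrow> g \<in> U \<Longrightarrow> (\<lambda>i. f i + c * g i) \<in> U"
    and surj: "\<And>h. \<exists>f\<in>U. \<forall>i\<in>B. f i = h i"
    and inj: "\<And>f i. f \<in> U \<Longrightarrow> \<forall>j\<in>B. f j = 0 \<Longrightarrow> i \<in> I \<Longrightarrow> f i = 0"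
    and sum0: "\<And>f. f \<in> U \<Longrightarrow> sum f I = 0"
begin

text \<open>
  The points with index outside \<open>B\<close> are placed at \<open>0\<close> and the basis vectors; the dependency dual to
  \<open>b \<in> B\<close> then determines the point with index \<open>b\<close>.
\<close>

lemma gale_realization:
  assumes card_I: "card I = DIM('a::euclidean_space) + 1 + card B"
  obtains x :: "'i \<Rightarrow> 'a::euclidean_space"
  where "\<And>f. f \<in> U \<Longrightarrow> (\<Sum>i\<in>I. f i *\<^sub>R x i) = 0"
    and "affine hull (x ` I) = UNIV"
    and "\<And>f. sum f I = 0 \<Longrightarrow> (\<Sum>i\<in>I. f i *\<^sub>R x i) = 0 \<Longrightarrow> \<exists>g\<in>U. \<forall>i\<in>I. f i = g i"
    and "\<And>h. (\<And>f. f \<in> U \<Longrightarrow> (\<Sum>i\<in>I. h i * f i) = 0) \<Longrightarrow> \<exists>u e. \<forall>i\<in>I. u \<bullet> x i + e = h i"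
proof -
  define A where "A = I - B"
  have finA: "finite A" and finB: "finite B" using fin BI by (auto simp: A_def intro: finite_subset)
  have cardA: "card A = DIM('a) + 1"
    unfolding A_def using card_I card_Diff_subset[OF finB BI] by simp
  have split: "sum F I = sum F A + sum F B" for F :: "'i \<Rightarrow> 'z::comm_monoid_add"
    unfolding A_def using sum.subset_diff[OF BI fin] by simp
  have "card (insert (0::'a) Basis) = DIM('a) + 1"
    using nonzero_Basis by (subst card_insert_disjoint) auto
  then obtain h where h: "bij_betw h A (insert (0::'a) Basis)"
    using finA cardA finite_same_card_bij[of A "insert (0::'a) Basis"] by auto
  have "\<forall>b. \<exists>f\<in>U. \<forall>i\<in>B. f i = (if i = b then 1 else 0)"
    by (intro allI surj)
  then obtain e where eU: "\<And>b. e b \<in> U"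
    and eB: "\<And>b i. i \<in> B \<Longrightarrow> e b i = (if i = b then 1 else 0)"
    by metis
  define x where "x i = (if i \<in> A then h i else - (\<Sum>a\<in>A. e i a *\<^sub>R h a))" for i
  have xA: "x i = h i" if "i \<in> A" for i using that by (simp add: x_def)
  have xB: "x i = - (\<Sum>a\<in>A. e i a *\<^sub>R h a)" if "i \<in> B" for i
    using that by (auto simp: x_def A_def)
  have expand: "f i = (\<Sum>b\<in>B. f b * e b i)" if f: "f \<in> U" and i: "i \<in> I" for f i
  proof -
    have "(\<lambda>i. f i - (\<Sum>b\<in>C. f b * e b i)) \<in> U" if "finite C" for C
      using that
    proof induction
      case empty
      then show ?case using f by simp
    next
      case (insert c C)
      then show ?case using lin[OF insert.IH eU, of "- f c" c] by (simp add: algebra_simps)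
    qed
    from this[OF finB] have "f i - (\<Sum>b\<in>B. f b * e b i) = 0"
      by (rule inj) (use i finB in \<open>auto simp: eB mult_delta_right\<close>)
    then show ?thesis by simp
  qed
  have R1: "(\<Sum>i\<in>I. f i *\<^sub>R x i) = 0" if f: "f \<in> U" for f
  proof -
    have "(\<Sum>i\<in>A. f i *\<^sub>R x i) = (\<Sum>a\<in>A. (\<Sum>b\<in>B. f b * e b a) *\<^sub>R h a)"
      by (rule sum.cong) (use expand[OF f] in \<open>auto simp: xA A_def\<close>)
    also have "\<dots> = (\<Sum>b\<in>B. \<Sum>a\<in>A. (f b * e b a) *\<^sub>R h a)"
      unfolding scaleR_sum_left by (rule sum.swap)
    also have "\<dots> = - (\<Sum>i\<in>B. f i *\<^sub>R x i)"
      by (simp add: xB scaleR_sum_right sum_negf)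
    finally show ?thesis by (simp add: split)
  qed
  have interp: "\<exists>u c. \<forall>a\<in>A. u \<bullet> h a + c = p a" for p :: "'i \<Rightarrow> real"
  proof -
    obtain g where g: "\<And>a. a \<in> A \<Longrightarrow> g (h a) = a"
      using h by (metis bij_betw_inv_into_left)
    define c where "c = p (g 0)"
    define u where "u = (\<Sum>i\<in>Basis. (p (g i) - c) *\<^sub>R i)"
    have "u \<bullet> h a + c = p a" if a: "a \<in> A" for a
    proof (cases "h a = 0")
      case True
      then show ?thesis using g[OF a] by (simp add: c_def)
    next
      case False
      then have "h a \<in> Basis" using h a by (auto simp: bij_betw_def)
      then show ?thesis using g[OF a] by (simp add: u_def)
    qed
    then show ?thesis by blast
  qed
  have affine: "affine hull (x ` I) = UNIV"
  proof -
    have "x ` A = insert 0 Basis" using h xA by (auto simp: bij_betw_def)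
    then have "affine hull (x ` A) = UNIV"
      by (simp add: affine_hull_span_0 hull_inc)
    moreover have "x ` A \<subseteq> x ` I" by (auto simp: A_def)
    ultimately show ?thesis by (metis hull_mono top.extremum_uniqueI)
  qed
  have R2: "\<exists>g\<in>U. \<forall>i\<in>I. f i = g i"
    if s: "sum f I = 0" and sx: "(\<Sum>i\<in>I. f i *\<^sub>R x i) = 0" for f
  proof -
    obtain g where g: "g \<in> U" "\<forall>i\<in>B. g i = f i" using surj by blast
    \<comment> \<open>\<open>k\<close> vanishes on \<open>B\<close>, and the points indexed by
      \<open>A\<close> are affinely independent: an affine function equal to 1 at \<open>a\<close>
      and 0 at the others isolates \<open>k a\<close>.\<close>
    define k where "k i = f i - g i" for i
    have kB: "k i = 0" if "i \<in> B" for i using that g by (simp add: k_def)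
    have "sum k I = 0" "(\<Sum>i\<in>I. k i *\<^sub>R x i) = 0"
      using s sx R1[OF g(1)] sum0[OF g(1)]
      by (simp_all add: k_def sum_subtractf scaleR_left_diff_distrib)
    then have kA: "sum k A = 0" "(\<Sum>i\<in>A. k i *\<^sub>R h i) = 0"
      by (simp_all add: split kB xA)
    have "k a = 0" if a: "a \<in> A" for a
    proof -
      obtain u c where uc: "\<forall>i\<in>A. u \<bullet> h i + c = (if i = a then 1 else 0)"
        using interp[of "\<lambda>i. if i = a then 1 else 0"] by blast
      have "k a = (\<Sum>i\<in>A. k i * (if i = a then 1 else 0))"
        using a finA by (simp add: mult_delta_right)
      also have "\<dots> = (\<Sum>i\<in>A. k i * (u \<bullet> h i + c))" using uc by simp
      also have "\<dots> = u \<bullet> (\<Sum>i\<in>A. k i *\<^sub>R h i) + sum k A * c"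
        by (simp add: inner_sum_right distrib_left sum.distrib sum_distrib_right)
      finally show ?thesis using kA by simp
    qed
    then have "\<forall>i\<in>I. f i = g i" using kB by (auto simp: k_def A_def)
    then show ?thesis using g(1) by blast
  qed
  have R3: "\<exists>u c. \<forall>i\<in>I. u \<bullet> x i + c = p i"
    if p: "\<And>f. f \<in> U \<Longrightarrow> (\<Sum>i\<in>I. p i * f i) = 0" for p
  proof -
    obtain u c where uc: "\<forall>a\<in>A. u \<bullet> h a + c = p a" using interp by blast
    \<comment> \<open>\<open>q\<close> vanishes on \<open>A\<close> and is orthogonal to
      \<open>U\<close>; pairing it with the element of \<open>U\<close> that agrees with it on
      \<open>B\<close> gives its sum of squares.\<close>
    define q where "q i = u \<bullet> x i + c - p i" for i
    have qA: "q i = 0" if "i \<in> A" for i using that uc by (simp add: q_def xA)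
    obtain f where f: "f \<in> U" "\<forall>i\<in>B. f i = q i" using surj by blast
    have "(\<Sum>i\<in>I. q i * f i) = u \<bullet> (\<Sum>i\<in>I. f i *\<^sub>R x i) + c * sum f I - (\<Sum>i\<in>I. p i * f i)"
      by (simp add: q_def algebra_simps sum.distrib sum_subtractf inner_sum_right sum_distrib_left)
    also have "\<dots> = 0" using p[OF f(1)] R1[OF f(1)] sum0[OF f(1)] by simp
    finally have "(\<Sum>i\<in>B. q i * q i) = 0" using f(2) by (simp add: split qA)
    then have "\<forall>i\<in>B. q i = 0" using finB by (simp add: sum_nonneg_eq_0_iff)
    then have "\<forall>i\<in>I. u \<bullet> x i + c = p i" using qA by (auto simp: q_def A_def)
    then show ?thesis by blast
  qed
  show thesis using that[OF R1 affine R2 R3] by blast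
qed

text \<open>By \<open>spanning\<close> all points are vertices: one in the hull of the others would
  give a dependency with a single negative entry. By \<open>facet_orth\<close>, \<open>p\<close>
  extends to an affine function; its zero face has at least \<open>DIM('a) + 1\<close> vertices,
  whereas a facet that is a simplex has only \<open>DIM('a)\<close>.\<close>

lemma nonsimplicial_illuminated_polytope:
  assumes card_I: "card I = DIM('a::euclidean_space) + 1 + card B"
    and spanning: "\<And>f v i. f \<in> U \<Longrightarrow> \<forall>j\<in>I. j \<noteq> v \<longrightarrow> f j \<ge> 0 \<Longrightarrow> i \<in> I \<Longrightarrow> f i = 0"
    and diagonal: "\<And>v. v \<in> I \<Longrightarrow> \<exists>w\<in>I. \<exists>f\<in>U. w \<noteq> v \<and> f v < 0 \<and> f w < 0 \<and>
          (\<forall>i\<in>I. i \<noteq> v \<longrightarrow> i \<noteq> w \<longrightarrow> f i > 0)"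
    and facet_orth: "\<And>f. f \<in> U \<Longrightarrow> (\<Sum>i\<in>I. p i * f i) = 0"
    and facet_nonneg: "\<And>i. i \<in> I \<Longrightarrow> p i \<ge> 0"
    and facet_nonzero: "\<exists>i\<in>I. p i \<noteq> 0"
    and facet_card: "card {i\<in>I. p i \<noteq> 0} \<le> card B"
  obtains P :: "'a::euclidean_space set"
  where "d_polytope P" "illuminated P" "f0 P = card I" "\<not> simplicial P"
proof -
  obtain x :: "'i \<Rightarrow> 'a" where
    R1: "\<And>f. f \<in> U \<Longrightarrow> (\<Sum>i\<in>I. f i *\<^sub>R x i) = 0"
    and affine: "affine hull (x ` I) = UNIV"
    and R2: "\<And>f. sum f I = 0 \<Longrightarrow> (\<Sum>i\<in>I. f i *\<^sub>R x i) = 0 \<Longrightarrow> \<exists>g\<in>U. \<forall>i\<in>I. f i = g i"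
    and R3: "\<And>h. (\<And>f. f \<in> U \<Longrightarrow> (\<Sum>i\<in>I. h i * f i) = 0) \<Longrightarrow> \<exists>u e. \<forall>i\<in>I. u \<bullet> x i + e = h i"
    using gale_realization[OF card_I] by blast
  define P where "P = convex hull (x ` I)"
  have finx: "finite (x ` I)" using fin by simp
  have nothull: "x v \<notin> convex hull (x ` (I - {v}))" if v: "v \<in> I" for v
  proof
    assume "x v \<in> convex hull (x ` (I - {v}))"
    then obtain c where c: "\<forall>i\<in>I - {v}. 0 \<le> c i" "sum c (I - {v}) = 1"
      "(\<Sum>i\<in>I - {v}. c i *\<^sub>R x i) = x v"
      using convex_hull_image_weights[of "I - {v}"] fin by blast
    define f where "f i = (if i = v then -1 else c i)" for i
    have "sum f I = f v + sum f (I - {v})" "(\<Sum>i\<in>I. f i *\<^sub>R x i) = f v *\<^sub>R x v + (\<Sum>i\<in>I - {v}. f i *\<^sub>R x i)"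
      using sum.remove[OF fin v] by blast+
    then have "sum f I = 0" "(\<Sum>i\<in>I. f i *\<^sub>R x i) = 0"
      using c by (simp_all add: f_def)
    then obtain g where g: "g \<in> U" "\<forall>i\<in>I. f i = g i" using R2 by blast
    have "g j \<ge> 0" if "j \<in> I" "j \<noteq> v" for j
    proof -
      have "0 \<le> c j" using that c(1) by blast
      then show ?thesis using bspec[OF g(2) that(1)] that(2) by (simp add: f_def)
    qed
    then have "g v = 0" using spanning[OF g(1), of v v] v by blast
    then show False using g v by (auto simp: f_def)
  qed
  have injx: "inj_on x I"
  proof (rule inj_onI)
    fix v w assume vw: "v \<in> I" "w \<in> I" "x v = x w"
    show "v = w"
    proof (rule ccontr)
      assume "v \<noteq> w"
      then have "x v \<in> x ` (I - {v})" using vw by auto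
      then show False using nothull[OF vw(1)] hull_inc by metis
    qed
  qed
  have ext: "y extreme_point_of P \<longleftrightarrow> y \<in> x ` I" for y
    unfolding P_def
  proof (rule extreme_point_of_convex_hull_convex_independent)
    show "compact (x ` I)" using finx by (rule finite_imp_compact)
    fix y assume "y \<in> x ` I"
    then obtain v where v: "v \<in> I" "y = x v" by blast
    then have "x ` I - {y} = x ` (I - {v})" using injx by (auto simp: inj_on_def)
    then show "y \<notin> convex hull (x ` I - {y})" using nothull v by simp
  qed
  have vert: "vertices P = x ` I" by (auto simp: vertices_def ext)
  have f0: "f0 P = card I" by (simp add: f0_def vert card_image injx)
  have poly: "polytope P" unfolding P_def polytope_def using finx by blast
  have affP: "affine hull P = UNIV" by (simp add: P_def affine)
  have dimP: "aff_dim P = int DIM('a)"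
    using affP by (metis aff_dim_UNIV aff_dim_affine_hull)
  have cvx: "convex P" by (simp add: P_def)
  have xP: "x i \<in> P" if "i \<in> I" for i using that by (simp add: P_def hull_inc)
  have illum: "illuminated P"
    unfolding illuminated_def vert
  proof
    fix y assume "y \<in> x ` I"
    then obtain v where v: "v \<in> I" and y: "y = x v" by blast
    obtain w f where w: "w \<in> I" "w \<noteq> v" and f: "f \<in> U" "f v < 0" "f w < 0"
      and fpos: "\<forall>i\<in>I. i \<noteq> v \<longrightarrow> i \<noteq> w \<longrightarrow> f i > 0"
      using diagonal[OF v] by blast
    \<comment> \<open>\<open>z\<close> divides the segment in proportion to \<open>f v\<close> and
      \<open>f w\<close>, so the dependency also writes it as a convex combination of all other
      points with positive weights. A functional supporting \<open>P\<close> at \<open>z\<close> is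
      therefore constant on \<open>P\<close>.\<close>
    define r where "r = f w / (f v + f w)"
    define z where "z = (1 - r) *\<^sub>R x v + r *\<^sub>R x w"
    have r: "0 \<le> r" "r \<le> 1" using f by (auto simp: r_def field_simps)
    have zseg: "z \<in> closed_segment (x v) (x w)"
      unfolding closed_segment_def z_def using r by blast
    have zP: "z \<in> P" using zseg xP[OF v] xP[OF w(1)] cvx
      by (meson closed_segment_subset subsetD)
    have "z \<in> interior P"
    proof (rule ccontr)
      assume "z \<notin> interior P"
      then have "z \<notin> rel_interior P" using rel_interior_interior[OF affP] by simp
      then obtain u where u: "\<And>y. y \<in> P \<Longrightarrow> u \<bullet> z \<le> u \<bullet> y"
        "\<And>y. y \<in> rel_interior P \<Longrightarrow> u \<bullet> z < u \<bullet> y"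
        using supporting_hyperplane_rel_boundary[OF cvx zP] by metis
      define q where "q i = u \<bullet> x i - u \<bullet> z" for i
      have qnn: "q i \<ge> 0" if "i \<in> I" for i using u(1)[OF xP[OF that]] by (simp add: q_def)
      have rq: "(1 - r) * q v + r * q w = 0"
        by (simp add: q_def z_def algebra_simps)
      have "(f v + f w) * (1 - r) = f v" "(f v + f w) * r = f w"
        using f by (simp_all add: r_def field_simps)
      moreover have "((f v + f w) * (1 - r)) * q v + ((f v + f w) * r) * q w
          = (f v + f w) * ((1 - r) * q v + r * q w)"
        by (simp only: distrib_left mult.assoc)
      ultimately have "f v * q v + f w * q w = (f v + f w) * ((1 - r) * q v + r * q w)"
        by simp
      then have vw0: "f v * q v + f w * q w = 0" using rq by simp
      have "f v * q v \<le> 0" "f w * q w \<le> 0"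
        using f qnn[OF v] qnn[OF w(1)] by (simp_all add: mult_nonpos_nonneg)
      then have "f v * q v = 0" "f w * q w = 0" using vw0 by linarith+
      then have qvw: "q v = 0" "q w = 0" using f by auto
      have "(\<Sum>i\<in>I. f i * q i) = u \<bullet> (\<Sum>i\<in>I. f i *\<^sub>R x i) - sum f I * (u \<bullet> z)"
        by (simp add: q_def right_diff_distrib sum_subtractf inner_sum_right sum_distrib_right)
      also have "\<dots> = 0" using R1[OF f(1)] sum0[OF f(1)] by simp
      finally have "(\<Sum>i\<in>I. f i * q i) = 0" .
      moreover have "f i * q i \<ge> 0" if "i \<in> I" for i
        using that fpos qnn[OF that] qvw by (cases "i = v \<or> i = w") (auto simp: less_imp_le)
      ultimately have fq: "\<forall>i\<in>I. f i * q i = 0" using fin by (simp add: sum_nonneg_eq_0_iff)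
      have q0: "q i = 0" if "i \<in> I" for i
        using fq fpos qvw that by (metis less_irrefl mult_eq_0_iff)
      have "P \<subseteq> {y. u \<bullet> y = u \<bullet> z}"
        unfolding P_def by (rule hull_minimal) (use q0 in \<open>auto simp: q_def convex_hyperplane\<close>)
      moreover obtain y where "y \<in> rel_interior P"
        using zP cvx rel_interior_eq_empty by blast
      ultimately show False using u(2)[of y] rel_interior_subset[of P] by auto
    qed
    then have "inner_diagonal P y (x w)"
      unfolding inner_diagonal_def vert using v w y zseg injx by (auto simp: inj_on_def)
    then show "\<exists>w. inner_diagonal P y w" by blast
  qed
  have "\<not> simplicial P"
  proof
    assume simp: "simplicial P"
    obtain u e where ue: "\<forall>i\<in>I. u \<bullet> x i + e = p i" using R3 facet_orth by blast
    define F where "F = P \<inter> {y. u \<bullet> y = - e}"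
    have "P \<subseteq> {y. u \<bullet> y \<ge> - e}"
      unfolding P_def
    proof (rule hull_minimal)
      show "x ` I \<subseteq> {y. - e \<le> u \<bullet> y}" using ue facet_nonneg by force
    qed (simp add: convex_halfspace_ge)
    then have face: "F face_of P"
      unfolding F_def using cvx by (intro face_of_Int_supporting_hyperplane_ge) auto
    define Z where "Z = {i\<in>I. p i = 0}"
    have "card (Z \<union> {i\<in>I. p i \<noteq> 0}) = card Z + card {i\<in>I. p i \<noteq> 0}"
      by (rule card_Un_disjoint) (use fin in \<open>auto simp: Z_def\<close>)
    moreover have "Z \<union> {i\<in>I. p i \<noteq> 0} = I" by (auto simp: Z_def)
    ultimately have "card I = card Z + card {i\<in>I. p i \<noteq> 0}" by simp
    then have cardZ: "card Z \<ge> DIM('a) + 1" using card_I facet_card by linarith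
    have ZF: "x i \<in> F" if "i \<in> Z" for i
      using that ue xP by (force simp: F_def Z_def)
    obtain i where "i \<in> Z" using cardZ by (metis card.empty add_is_0 equals0I le_zero_eq one_neq_zero)
    then have "F \<noteq> {}" using ZF by blast
    moreover have "F \<noteq> P"
    proof -
      obtain i where "i \<in> I" "p i \<noteq> 0" using facet_nonzero by blast
      then have "x i \<notin> F" using ue by (force simp: F_def)
      then show ?thesis using xP \<open>i \<in> I\<close> by blast
    qed
    ultimately obtain G where G: "G facet_of P" "F \<subseteq> G"
      using face_of_polyhedron_subset_facet[OF polytope_imp_polyhedron[OF poly] face] by blast
    obtain k where k: "k simplex G" using simp G(1) unfolding simplicial_def by blast
    have "aff_dim G = int DIM('a) - 1" using G(1) dimP by (simp add: facet_of_def)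
    then have kd: "k = int DIM('a) - 1" using aff_dim_simplex[OF k] by simp
    obtain C where C: "finite C" "int (card C) = k + 1" "G = convex hull C"
      using k unfolding simplex by blast
    have "x ` Z \<subseteq> C"
    proof
      fix y assume "y \<in> x ` Z"
      then have "y extreme_point_of P" "y \<in> G" using ext ZF G(2) by (auto simp: Z_def)
      then have "y extreme_point_of G"
        using extreme_point_of_face[OF facet_of_imp_face_of[OF G(1)]] by blast
      then show "y \<in> C" using C(3) extreme_point_of_convex_hull by metis
    qed
    then have "card (x ` Z) \<le> card C" using C(1) by (rule card_mono[rotated])
    moreover have "card (x ` Z) = card Z"
      by (rule card_image) (rule inj_on_subset[OF injx], auto simp: Z_def)
    ultimately show False using cardZ C(2) kd by linarith
  qed
  then show thesis
    using that[of P] illum f0 poly dimP by (simp add: d_polytope_def)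
qed

end

section \<open>The star configuration and its linear algebra\<close>

locale star_diagram =
  fixes a b m :: nat
  assumes a2: "2 \<le> a" and b3: "3 \<le> b" and ma: "m < a"
begin

definition rho :: real where "rho = real a * real b - 1"

text \<open>
  Star \<open>t\<close> consists of the hub \<open>(t, b)\<close> and the leaves \<open>(t, j)\<close>, \<open>j < b\<close>.
  In an ordinary star the leaves are the vectors \<open>v\<^sub>j = (p\<^sub>t, e\<^sub>j)\<close>.
  In star \<open>0\<close> the first three are replaced by the midpoints of the pairs among them, which makes a
  small positive circuit possible. In the stars \<open>1, \<dots>, m\<close> the first two are replaced by their sum,
  which is stored at \<open>j = 1\<close>, while the index \<open>(t, 0)\<close> is unused and has value \<open>0\<close>.
  All these changes preserve the sum of the leaves of a star.
\<close>

definition leaf :: "(nat \<Rightarrow> real) \<Rightarrow> (nat \<Rightarrow> real) \<Rightarrow> nat \<Rightarrow> nat \<Rightarrow> real" where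
  "leaf \<alpha> \<beta> t j =
    (if t = 0 \<and> j < 3 then \<alpha> 0 + (\<beta> j + \<beta> ((j + 1) mod 3)) / 2
     else if 1 \<le> t \<and> t \<le> m \<and> j < 2 then (if j = 0 then 0 else 2 * \<alpha> t + \<beta> 0 + \<beta> 1)
     else \<alpha> t + \<beta> j)"

text \<open>A linear functional has the value \<open>\<alpha> t\<close> at \<open>p\<^sub>t\<close>
  and \<open>\<beta> j\<close> at \<open>e\<^sub>j\<close>; \<open>val\<close> evaluates it on the
  configuration. The relation between the \<open>p\<^sub>t\<close> becomes the constraint in
  \<open>deps\<close>.\<close>

definition val :: "(nat \<Rightarrow> real) \<Rightarrow> (nat \<Rightarrow> real) \<Rightarrow> nat \<times> nat \<Rightarrow> real" where
  "val \<alpha> \<beta> = (\<lambda>(t, j). if j = b then rho * \<alpha> t - (\<Sum>i<b. \<beta> i) else leaf \<alpha> \<beta> t j)"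

definition idx :: "(nat \<times> nat) set" where
  "idx = {..a} \<times> {..b} - {1..m} \<times> {0}"

text \<open>Star \<open>a\<close> is ordinary since \<open>m < a\<close>, so its leaves give each
  \<open>\<beta> j\<close> up to \<open>\<alpha> a\<close>; the hubs then give the other
  \<open>\<alpha> t\<close>.\<close>

definition bas :: "(nat \<times> nat) set" where
  "bas = {a} \<times> {..<b} \<union> {..<a} \<times> {b}"

definition deps :: "(nat \<times> nat \<Rightarrow> real) set" where
  "deps = {val \<alpha> \<beta> | \<alpha> \<beta>. (\<Sum>t\<le>a. \<alpha> t) = 0}"

lemma rho_bounds: "rho > b" "rho < real a * real b" "rho > 0"
proof -
  have "real b * 2 \<le> real b * real a" using a2 by (intro mult_left_mono) auto
  then have "real a * real b \<ge> 2 * real b" by (simp add: mult.commute)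
  then show "rho > b" "rho > 0" using b3 unfolding rho_def by linarith+
qed (simp add: rho_def)

lemma finite_idx: "finite idx" by (simp add: idx_def)

lemma card_idx: "card idx = (a + 1) * (b + 1) - m"
proof -
  have "card idx = card ({..a} \<times> {..b}) - card ({1..m} \<times> {0::nat})"
    unfolding idx_def by (rule card_Diff_subset) (use ma in auto)
  then show ?thesis by simp
qed

lemma card_bas: "card bas = a + b"
  unfolding bas_def by (subst card_Un_disjoint) auto

lemma bas_subset: "bas \<subseteq> idx"
  using ma b3 by (auto simp: bas_def idx_def)

lemma sum_split3: "(\<Sum>j<b. f j) = f 0 + f 1 + f 2 + (\<Sum>j=3..<b. f j)" for f :: "nat \<Rightarrow> real"
proof -
  have "{..<b} = {0, 1, 2} \<union> {3..<b}" using b3 by auto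
  then have "(\<Sum>j<b. f j) = (\<Sum>j\<in>{0, 1, 2} \<union> {3..<b}. f j)" by simp
  also have "\<dots> = (\<Sum>j\<in>{0, 1, 2}. f j) + (\<Sum>j=3..<b. f j)"
    by (rule sum.union_disjoint) auto
  finally show ?thesis by simp
qed

lemma leaf_sum: "(\<Sum>j<b. leaf \<alpha> \<beta> t j) = real b * \<alpha> t + (\<Sum>j<b. \<beta> j)"
proof -
  have "(\<Sum>j=3..<b. leaf \<alpha> \<beta> t j) = (\<Sum>j=3..<b. \<alpha> t + \<beta> j)"
    by (rule sum.cong) (auto simp: leaf_def)
  also have "\<dots> = real (b - 3) * \<alpha> t + (\<Sum>j=3..<b. \<beta> j)"
    by (simp add: sum.distrib)
  moreover have "leaf \<alpha> \<beta> t 0 + leaf \<alpha> \<beta> t 1 + leaf \<alpha> \<beta> t 2 = 3 * \<alpha> t + \<beta> 0 + \<beta> 1 + \<beta> 2"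
    by (simp add: leaf_def field_simps numeral_2_eq_2)
  ultimately show ?thesis using b3 unfolding sum_split3
    by (simp add: algebra_simps)
qed

lemma sum_idx:
  assumes "\<And>t. t \<in> {1..m} \<Longrightarrow> F (t, 0) = (0::real)"
  shows "sum F idx = (\<Sum>t\<le>a. (\<Sum>j<b. F (t, j)) + F (t, b))"
proof -
  have "sum F idx = sum F ({..a} \<times> {..b})"
    by (rule sum.mono_neutral_left) (use assms in \<open>auto simp: idx_def\<close>)
  also have "\<dots> = (\<Sum>t\<le>a. \<Sum>j\<le>b. F (t, j))"
    by (simp add: sum.cartesian_product)
  finally show ?thesis by (simp add: lessThan_Suc_atMost[symmetric])
qed

lemma val_hub: "val \<alpha> \<beta> (t, b) = rho * \<alpha> t - (\<Sum>i<b. \<beta> i)"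
  by (simp add: val_def)

lemma val_leaf: "j < b \<Longrightarrow> val \<alpha> \<beta> (t, j) = leaf \<alpha> \<beta> t j"
  by (simp add: val_def)

lemma val_merged: "t \<in> {1..m} \<Longrightarrow> val \<alpha> \<beta> (t, 0) = 0"
  using b3 by (simp add: val_def leaf_def)

lemma star_sum: "(\<Sum>j<b. val \<alpha> \<beta> (t, j)) = real b * \<alpha> t + (\<Sum>j<b. \<beta> j)"
  using leaf_sum by (simp add: val_leaf)

lemma idx_cases:
  assumes "t \<le> a" "j \<le> b"
  shows "(t, j) \<in> idx \<or> val \<alpha> \<beta> (t, j) = 0"
  using assms by (cases "j = 0") (auto simp: idx_def val_merged)

lemma val_zero:
  assumes "\<And>t. t \<le> a \<Longrightarrow> \<alpha> t = 0" "\<And>j. j < b \<Longrightarrow> \<beta> j = 0" "i \<in> idx"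
  shows "val \<alpha> \<beta> i = 0"
proof -
  obtain t j where i: "i = (t, j)" "t \<le> a" "j \<le> b" using assms(3) by (auto simp: idx_def)
  have "j < 3 \<Longrightarrow> (j + 1) mod 3 < b" using b3 by (meson less_le_trans mod_less_divisor zero_less_numeral)
  then show ?thesis using i assms b3 by (auto simp: val_def leaf_def)
qed

lemma val_linear: "val (\<lambda>t. \<alpha> t + c * \<alpha>' t) (\<lambda>j. \<beta> j + c * \<beta>' j) i = val \<alpha> \<beta> i + c * val \<alpha>' \<beta>' i"
  by (cases i) (simp add: val_def leaf_def sum.distrib sum_distrib_left[symmetric] algebra_simps add_divide_distrib)

sublocale dependency_space deps idx bas
proof
  show "finite idx" by (rule finite_idx)
  show "bas \<subseteq> idx" by (rule bas_subset)
next
  fix f g :: "nat \<times> nat \<Rightarrow> real" and c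
  assume "f \<in> deps" "g \<in> deps"
  then obtain \<alpha> \<beta> \<alpha>' \<beta>' where "f = val \<alpha> \<beta>" "(\<Sum>t\<le>a. \<alpha> t) = 0" "g = val \<alpha>' \<beta>'" "(\<Sum>t\<le>a. \<alpha>' t) = 0"
    by (auto simp: deps_def)
  then show "(\<lambda>i. f i + c * g i) \<in> deps"
    unfolding deps_def mem_Collect_eq
    by (intro exI[of _ "\<lambda>t. \<alpha> t + c * \<alpha>' t"] exI[of _ "\<lambda>j. \<beta> j + c * \<beta>' j"])
      (auto simp: val_linear sum.distrib sum_distrib_left[symmetric])
next
  fix h :: "nat \<times> nat \<Rightarrow> real"
  \<comment> \<open>The forced value of \<open>\<alpha> a\<close>: the constraint on
    \<open>\<alpha>\<close> reduces to \<open>(rho - a * b) * \<alpha> a = - A\<close>, and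
    \<open>rho - a * b = -1\<close>.\<close>
  define A where "A = (\<Sum>s<a. h (s, b)) + real a * (\<Sum>j<b. h (a, j))"
  define \<beta> where "\<beta> j = h (a, j) - A" for j
  define \<alpha> where "\<alpha> t = (if t = a then A else (h (t, b) + (\<Sum>j<b. \<beta> j)) / rho)" for t
  have "(\<Sum>t\<le>a. \<alpha> t) = A + (\<Sum>t<a. (h (t, b) + (\<Sum>j<b. \<beta> j)) / rho)"
    by (simp add: lessThan_Suc_atMost[symmetric] \<alpha>_def)
  also have "(\<Sum>t<a. (h (t, b) + (\<Sum>j<b. \<beta> j)) / rho) = (A - real a * real b * A) / rho"
    unfolding sum_divide_distrib[symmetric]
    by (simp add: sum.distrib \<beta>_def sum_subtractf A_def algebra_simps)
  also have "\<dots> = - A" using rho_bounds(3) by (simp add: field_simps) (simp add: rho_def algebra_simps)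
  finally have "(\<Sum>t\<le>a. \<alpha> t) = 0" by simp
  moreover have "val \<alpha> \<beta> i = h i" if "i \<in> bas" for i
    using that ma b3 rho_bounds(3) by (auto simp: bas_def val_def leaf_def \<alpha>_def) (simp add: \<beta>_def)
  ultimately show "\<exists>f\<in>deps. \<forall>i\<in>bas. f i = h i" unfolding deps_def by blast
next
  fix f i
  assume "f \<in> deps" and f0: "\<forall>j\<in>bas. f j = 0" and i: "i \<in> idx"
  then obtain \<alpha> \<beta> where f: "f = val \<alpha> \<beta>" and \<alpha>: "(\<Sum>t\<le>a. \<alpha> t) = 0" by (auto simp: deps_def)
  have \<beta>: "\<beta> j = - \<alpha> a" if "j < b" for j
  proof -
    have "(a, j) \<in> bas" using that by (simp add: bas_def)
    then have "leaf \<alpha> \<beta> a j = 0" using f0 that by (auto simp: f val_leaf)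
    then show ?thesis using ma a2 by (simp add: leaf_def)
  qed
  have s\<beta>: "(\<Sum>j<b. \<beta> j) = - real b * \<alpha> a" using \<beta> by simp
  have h: "rho * \<alpha> t = - real b * \<alpha> a" if "t < a" for t
  proof -
    have "(t, b) \<in> bas" using that by (simp add: bas_def)
    then show ?thesis using f0 by (auto simp: f val_hub s\<beta>)
  qed
  have "0 = rho * (\<Sum>t\<le>a. \<alpha> t)" using \<alpha> by simp
  also have "\<dots> = rho * \<alpha> a + (\<Sum>t<a. rho * \<alpha> t)"
    by (simp add: lessThan_Suc_atMost[symmetric] distrib_left sum_distrib_left)
  also have "(\<Sum>t<a. rho * \<alpha> t) = - real a * real b * \<alpha> a" using h by simp
  finally have \<alpha>a: "\<alpha> a = 0" by (simp add: rho_def algebra_simps)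
  have "\<alpha> t = 0" if "t \<le> a" for t
    using h[of t] \<alpha>a rho_bounds(3) that by (cases "t = a") auto
  moreover have "\<beta> j = 0" if "j < b" for j using \<beta>[OF that] \<alpha>a by simp
  ultimately show "f i = 0" unfolding f using val_zero i by blast
next
  fix f :: "nat \<times> nat \<Rightarrow> real" assume "f \<in> deps"
  then obtain \<alpha> \<beta> where f: "f = val \<alpha> \<beta>" and \<alpha>: "(\<Sum>t\<le>a. \<alpha> t) = 0" by (auto simp: deps_def)
  have "sum f idx = (\<Sum>t\<le>a. (\<Sum>j<b. val \<alpha> \<beta> (t, j)) + val \<alpha> \<beta> (t, b))"
    unfolding f by (rule sum_idx) (rule val_merged)
  also have "\<dots> = (\<Sum>t\<le>a. (real b + rho) * \<alpha> t)"
    by (simp add: star_sum val_hub algebra_simps)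
  finally show "sum f idx = 0" using \<alpha> by (simp add: sum_distrib_left[symmetric])
qed

section \<open>All points are vertices\<close>

text \<open>In a star without \<open>v\<close>, adding the hub to the sum of the leaves cancels
  \<open>\<beta>\<close> and shows \<open>\<alpha> t \<ge> 0\<close>. A negative value in the star
  of \<open>v\<close> is excluded by \<open>rho < a * b\<close> if \<open>v\<close> is its hub and
  by \<open>rho > b\<close> otherwise. So \<open>\<alpha>\<close> vanishes, and one star without
  \<open>v\<close> forces \<open>\<beta>\<close> to vanish.\<close>

lemma deps_spanning:
  assumes f: "f \<in> deps" and v: "\<forall>j\<in>idx. j \<noteq> v \<longrightarrow> f j \<ge> 0" and i: "i \<in> idx"
  shows "f i = 0"
proof -
  obtain \<alpha> \<beta> where fv: "f = val \<alpha> \<beta>" and \<alpha>: "(\<Sum>t\<le>a. \<alpha> t) = 0" using f by (auto simp: deps_def)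
  obtain v1 v2 where v12: "v = (v1, v2)" by (cases v)
  have nn: "val \<alpha> \<beta> (t, j) \<ge> 0" if "t \<le> a" "j \<le> b" "t \<noteq> v1 \<or> j \<noteq> v2" for t j
    using idx_cases[OF that(1,2), of \<alpha> \<beta>] v that(3) by (auto simp: fv v12)
  have leaves: "real b * \<alpha> t + (\<Sum>j<b. \<beta> j) \<ge> 0" if "t \<le> a" "t \<noteq> v1 \<or> v2 = b" for t
    unfolding star_sum[symmetric] using that by (intro sum_nonneg nn) auto
  have hub: "rho * \<alpha> t \<ge> (\<Sum>j<b. \<beta> j)" if "t \<le> a" "t \<noteq> v1 \<or> v2 \<noteq> b" for t
    using nn[of t b] that by (auto simp: val_hub)
  have \<alpha>_nn: "\<alpha> t \<ge> 0" if "t \<le> a" "t \<noteq> v1" for t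
  proof -
    have "0 \<le> (real b + rho) * \<alpha> t" using leaves[of t] hub[of t] that by (simp add: algebra_simps)
    then show ?thesis using rho_bounds(3) by (simp add: zero_le_mult_iff)
  qed
  have \<alpha>_all: "\<alpha> t \<ge> 0" if "t \<le> a" for t
  proof (rule ccontr)
    assume neg: "\<not> \<alpha> t \<ge> 0"
    then have t: "t = v1" using \<alpha>_nn that by blast
    define x where "x = - \<alpha> t"
    have x: "x > 0" using neg by (simp add: x_def)
    have rest: "(\<Sum>s\<in>{..a} - {t}. \<alpha> s) = x"
      using \<alpha> that by (simp add: sum_diff1 x_def)
    show False
    proof (cases "v2 = b")
      case True
      then have "real b * x \<le> (\<Sum>j<b. \<beta> j)" using leaves[of t] that by (simp add: x_def)
      then have "real b * x \<le> rho * \<alpha> s" if "s \<in> {..a} - {t}" for s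
        using hub[of s] that t by force
      then have "(\<Sum>s\<in>{..a} - {t}. real b * x) \<le> (\<Sum>s\<in>{..a} - {t}. rho * \<alpha> s)"
        by (rule sum_mono)
      then have "real a * real b * x \<le> rho * x"
        using that by (simp add: sum_distrib_left[symmetric] rest)
      then show False using rho_bounds(2) x by simp
    next
      case False
      then have S: "(\<Sum>j<b. \<beta> j) \<le> - rho * x" using hub[of t] that by (simp add: x_def)
      obtain s where s: "s \<le> a" "s \<noteq> t" using a2 by (metis le0 zero_neq_numeral order_refl)
      have "\<alpha> s \<le> (\<Sum>s\<in>{..a} - {t}. \<alpha> s)"
        by (rule member_le_sum) (use s t \<alpha>_nn in auto)
      then have "real b * \<alpha> s \<le> real b * x" using rest by (simp add: mult_left_mono)
      moreover have "real b * x < rho * x" using rho_bounds(1) x by simp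
      ultimately show False using leaves[of s] s t S by simp
    qed
  qed
  have \<alpha>0: "\<alpha> t = 0" if "t \<le> a" for t
    using \<alpha> \<alpha>_all that by (subst (asm) sum_nonneg_eq_0_iff) auto
  \<comment> \<open>Only star 0 and the ordinary stars are sure to determine every
    \<open>\<beta> j\<close>; a merged leaf gives just a sum. One of the stars 0 and
    \<open>a\<close> avoids \<open>v\<close>.\<close>
  obtain u where u: "u = 0 \<or> u = a" "u \<noteq> v1" using a2 by (metis not_numeral_le_zero)
  then have ua: "u \<le> a" by auto
  have "(\<Sum>j<b. val \<alpha> \<beta> (u, j)) = 0"
    using leaves[of u] hub[of u] u ua \<alpha>0[OF ua] by (simp add: star_sum)
  then have "\<forall>j\<in>{..<b}. val \<alpha> \<beta> (u, j) = 0"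
    by (subst (asm) sum_nonneg_eq_0_iff) (use nn u ua in auto)
  then have l: "leaf \<alpha> \<beta> u j = 0" if "j < b" for j using that by (simp add: val_leaf)
  have "\<beta> j = 0" if j: "j < b" for j
    using u(1)
  proof
    assume u0: "u = 0"
    have "\<beta> 0 + \<beta> 1 = 0" "\<beta> 1 + \<beta> 2 = 0" "\<beta> 2 + \<beta> 0 = 0"
      using l[of 0] l[of 1] l[of 2] b3 \<alpha>0[of 0] by (simp_all add: leaf_def u0 numeral_2_eq_2)
    then have "\<beta> 0 = 0" "\<beta> 1 = 0" "\<beta> 2 = 0" by linarith+
    moreover have "\<beta> j = 0" if "\<not> j < 3"
      using l[OF j] that \<alpha>0[of 0] by (simp add: leaf_def u0)
    moreover have "j = 0 \<or> j = 1 \<or> j = 2" if "j < 3" using that by auto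
    ultimately show ?thesis by blast
  next
    assume "u = a"
    then show ?thesis using l[OF j] \<alpha>0[of a] ma by (simp add: leaf_def)
  qed
  then show ?thesis unfolding fv by (intro val_zero[OF _ _ i]) (auto simp: \<alpha>0)
qed

section \<open>Inner diagonals\<close>

text \<open>The coefficient of \<open>\<alpha> t\<close> in leaf \<open>i\<close> is \<open>leaf (\<lambda>_. 1) (\<lambda>_. 0) t i\<close>.\<close>

lemma separating_pattern:
  assumes t: "t \<le> a" and j: "j < b" and tj: "(t, j) \<in> idx"
  obtains \<gamma> :: "nat \<Rightarrow> real" where "\<And>i. \<gamma> i \<ge> 0" "(\<Sum>i<b. \<gamma> i) \<le> real b - 1"
    "leaf (\<lambda>_. 0) \<gamma> t j = 0"
    "\<And>i. i < b \<Longrightarrow> i \<noteq> j \<Longrightarrow> (t, i) \<in> idx \<Longrightarrow> leaf (\<lambda>_. 0) \<gamma> t i \<ge> leaf (\<lambda>_. 1) (\<lambda>_. 0) t i"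
proof (cases "t = 0 \<and> j < 3")
  case True
  \<comment> \<open>Leaf \<open>j\<close> averages two of the first three coordinates. Weight 2 on
    the third lifts both other midpoints to 1 and keeps the total at \<open>b - 1\<close>.\<close>
  define \<gamma> :: "nat \<Rightarrow> real" where
    "\<gamma> i = (if i < 3 then if i = (j + 2) mod 3 then 2 else 0 else 1)" for i
  have j3: "j = 0 \<or> j = 1 \<or> j = 2" using True by auto
  show thesis
  proof (rule that[of \<gamma>])
    show "(\<Sum>i<b. \<gamma> i) \<le> real b - 1"
      unfolding sum_split3 using j3 b3 by (auto simp: \<gamma>_def)
    show "leaf (\<lambda>_. 0) \<gamma> t j = 0"
      using True j3 by (auto simp: leaf_def \<gamma>_def)
    fix i assume i: "i < b" "i \<noteq> j"
    show "leaf (\<lambda>_. 0) \<gamma> t i \<ge> leaf (\<lambda>_. 1) (\<lambda>_. 0) t i"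
    proof (cases "i < 3")
      case True
      then have "i = 0 \<or> i = 1 \<or> i = 2" by auto
      then show ?thesis using \<open>t = 0 \<and> j < 3\<close> j3 i by (auto simp: leaf_def \<gamma>_def)
    qed (use True in \<open>simp add: leaf_def \<gamma>_def\<close>)
  qed (simp add: \<gamma>_def)
next
  case not0: False
  show thesis
  proof (cases "1 \<le> t \<and> t \<le> m \<and> j < 2")
    case True
    then have j1: "j = 1" using tj by (cases "j = 0") (auto simp: idx_def)
    define \<gamma> :: "nat \<Rightarrow> real" where "\<gamma> i = (if i < 2 then 0 else 1)" for i
    show thesis
    proof (rule that[of \<gamma>])
      show "(\<Sum>i<b. \<gamma> i) \<le> real b - 1"
        unfolding sum_split3 using b3 by (simp add: \<gamma>_def)
    qed (use True j1 in \<open>auto simp: \<gamma>_def leaf_def\<close>)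
  next
    case False
    define \<gamma> :: "nat \<Rightarrow> real" where "\<gamma> i = (if i = j then 0 else 1)" for i
    show thesis
    proof (rule that[of \<gamma>])
      have "(\<Sum>i<b. \<gamma> i) = \<gamma> j + (\<Sum>i\<in>{..<b} - {j}. \<gamma> i)"
        using j by (intro sum.remove) auto
      also have "(\<Sum>i\<in>{..<b} - {j}. \<gamma> i) = (\<Sum>i\<in>{..<b} - {j}. 1)"
        by (rule sum.cong) (auto simp: \<gamma>_def)
      finally show "(\<Sum>i<b. \<gamma> i) \<le> real b - 1" using j by (simp add: \<gamma>_def)
      show "leaf (\<lambda>_. 0) \<gamma> t j = 0"
        using False not0 by (auto simp: leaf_def \<gamma>_def)
      fix i assume i: "i < b" "i \<noteq> j"
      have "(i + 1) mod 3 < 3" by simp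
      then show "leaf (\<lambda>_. 0) \<gamma> t i \<ge> leaf (\<lambda>_. 1) (\<lambda>_. 0) t i"
        using False not0 i by (auto simp: leaf_def \<gamma>_def)
    qed (simp add: \<gamma>_def)
  qed
qed

text \<open>A leaf is paired with the hub of its star, and a hub with leaf 2, which exists in every
  star. Lowering \<open>\<alpha>\<close> at star \<open>t\<close> makes that star negative;
  \<open>\<beta>\<close>, a multiple of the separating pattern, lifts all its leaves except
  \<open>j\<close> above 0.\<close>

lemma deps_diagonal:
  assumes v: "v \<in> idx"
  shows "\<exists>w\<in>idx. \<exists>f\<in>deps. w \<noteq> v \<and> f v < 0 \<and> f w < 0 \<and> (\<forall>i\<in>idx. i \<noteq> v \<longrightarrow> i \<noteq> w \<longrightarrow> f i > 0)"
proof -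
  have main: "\<exists>f\<in>deps. f (t, j) < 0 \<and> f (t, b) < 0 \<and>
      (\<forall>i\<in>idx. i \<noteq> (t, j) \<longrightarrow> i \<noteq> (t, b) \<longrightarrow> f i > 0)"
    if tj: "(t, j) \<in> idx" "j < b" for t j
  proof -
    have t: "t \<le> a" using tj by (auto simp: idx_def)
    obtain \<gamma> where \<gamma>: "\<And>i. \<gamma> i \<ge> 0" "(\<Sum>i<b. \<gamma> i) \<le> real b - 1"
      "leaf (\<lambda>_. 0) \<gamma> t j = 0"
      "\<And>i. i < b \<Longrightarrow> i \<noteq> j \<Longrightarrow> (t, i) \<in> idx \<Longrightarrow> leaf (\<lambda>_. 0) \<gamma> t i \<ge> leaf (\<lambda>_. 1) (\<lambda>_. 0) t i"
      using separating_pattern[OF t tj(2,1)] by blast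
    \<comment> \<open>\<open>e > a\<close> makes the other leaves of star \<open>t\<close> positive,
      while \<open>e * (b - 1) < rho\<close>, which uses \<open>a \<ge> 2\<close>, keeps the hubs of
      the other stars positive.\<close>
    define e where "e = real a + 1 / real b"
    have e: "e > 0" "e > a" using b3 by (auto simp: e_def add_nonneg_pos)
    define \<beta> where "\<beta> j = e * \<gamma> j" for j
    define \<alpha> where "\<alpha> s = (if s = t then - real a else 1)" for s
    have "(\<Sum>s\<le>a. \<alpha> s) = \<alpha> t + (\<Sum>s\<in>{..a} - {t}. \<alpha> s)"
      using t by (intro sum.remove) auto
    also have "(\<Sum>s\<in>{..a} - {t}. \<alpha> s) = (\<Sum>s\<in>{..a} - {t}. 1)"
      by (rule sum.cong) (auto simp: \<alpha>_def)
    finally have \<alpha>: "(\<Sum>s\<le>a. \<alpha> s) = 0" using t by (simp add: \<alpha>_def)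
    have \<beta>: "\<beta> i \<ge> 0" for i using e \<gamma>(1) by (simp add: \<beta>_def)
    have "(\<Sum>i<b. \<beta> i) = e * (\<Sum>i<b. \<gamma> i)" by (simp add: \<beta>_def sum_distrib_left)
    also have "\<dots> \<le> e * (real b - 1)" using e \<gamma>(2) by (intro mult_left_mono) auto
    also have "\<dots> = real a * real b - real a + 1 - 1 / real b"
      using b3 by (simp add: e_def field_simps)
    also have "\<dots> < rho"
    proof -
      have "1 / real b > 0" using b3 by simp
      then show ?thesis using a2 unfolding rho_def by linarith
    qed
    finally have S: "(\<Sum>i<b. \<beta> i) < rho" .
    have S0: "(\<Sum>i<b. \<beta> i) \<ge> 0" using \<beta> by (simp add: sum_nonneg)
    have lt: "leaf \<alpha> \<beta> t i = e * leaf (\<lambda>_. 0) \<gamma> t i - a * leaf (\<lambda>_. 1) (\<lambda>_. 0) t i" for i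
      by (simp add: leaf_def \<alpha>_def \<beta>_def algebra_simps add_divide_distrib)
    have w: "leaf (\<lambda>_. 1) (\<lambda>_. 0) s i > 0" if "(s, i) \<in> idx" "i < b" for s i
      using that by (auto simp: leaf_def idx_def)
    have pos: "val \<alpha> \<beta> (s, i) > 0" if si: "(s, i) \<in> idx" "(s, i) \<noteq> (t, j)" "(s, i) \<noteq> (t, b)" for s i
    proof (cases "i = b")
      case True
      then show ?thesis using si S by (auto simp: val_hub \<alpha>_def)
    next
      case False
      then have i: "i < b" using si by (auto simp: idx_def)
      show ?thesis
      proof (cases "s = t")
        case True
        have "real a * leaf (\<lambda>_. 1) (\<lambda>_. 0) t i < e * leaf (\<lambda>_. 1) (\<lambda>_. 0) t i"
          using w[of t i] si i True e by (intro mult_strict_right_mono) auto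
        also have "\<dots> \<le> e * leaf (\<lambda>_. 0) \<gamma> t i"
          using \<gamma>(4)[OF i] si True e by (intro mult_left_mono) auto
        finally show ?thesis using i True by (simp add: val_leaf lt)
      next
        case False
        have "leaf \<alpha> \<beta> s i \<ge> leaf (\<lambda>_. 1) (\<lambda>_. 0) s i"
          using \<beta> False by (auto simp: leaf_def \<alpha>_def)
        then show ?thesis using w[OF si(1) i] i by (simp add: val_leaf)
      qed
    qed
    have "val \<alpha> \<beta> (t, j) < 0"
      using tj a2 w[OF tj] \<gamma>(3) by (simp add: val_leaf lt)
    moreover have "val \<alpha> \<beta> (t, b) < 0"
    proof -
      have "0 < rho * real a" using rho_bounds(3) a2 by simp
      then show ?thesis using S0 by (simp add: val_hub \<alpha>_def)
    qed
    moreover have "val \<alpha> \<beta> \<in> deps" using \<alpha> by (auto simp: deps_def)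
    ultimately show ?thesis using pos by (intro bexI[of _ "val \<alpha> \<beta>"]) auto
  qed
  obtain t j where tj: "v = (t, j)" by (cases v)
  have bounds: "t \<le> a" "j \<le> b" using v tj by (auto simp: idx_def)
  show ?thesis
  proof (cases "j = b")
    case True
    have "(t, 2) \<in> idx" "2 < b" using bounds b3 by (auto simp: idx_def)
    from main[OF this] this show ?thesis unfolding tj True
      by (intro bexI[of _ "(t, 2)"]) auto
  next
    case False
    then have "j < b" using bounds by simp
    moreover have "(t, b) \<in> idx" using bounds b3 by (auto simp: idx_def)
    ultimately show ?thesis using main[of t j] v unfolding tj
      by (intro bexI[of _ "(t, b)"]) auto
  qed
qed

section \<open>The facet with too many vertices\<close>

text \<open>
  The positive dependency among the Gale vectors behind the big facet: all the hubs, the leaf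
  \<open>(p\<^sub>0, (e\<^sub>0 + e\<^sub>1) / 2)\<close> of star \<open>0\<close> and the leaves \<open>(p\<^sub>a, e\<^sub>j)\<close>, \<open>j \<ge> 2\<close>, of star \<open>a\<close>; these are
  \<open>a + b\<close> vectors, one fewer than in a generic positive circuit in dimension \<open>a + b\<close>.
\<close>

definition load :: "nat \<Rightarrow> real" where
  "load t = (if t = 0 then 2 * (real a + 1) else if t = a then (real b - 2) * (real a + 1) else 0)"

text \<open>Subtracting \<open>load t\<close> at the hub gives every star the same coefficient
  \<open>rho * (b + rho)\<close> of \<open>\<alpha> t\<close>, so these terms cancel. The loads add
  up to \<open>b * (a + 1)\<close>, so the hubs contribute \<open>- rho * (a + 1)\<close> to each
  \<open>\<beta> j\<close>, which the leaves offset.\<close>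

definition facet_weight :: "nat \<times> nat \<Rightarrow> real" where
  "facet_weight = (\<lambda>(t, j). if j = b then real b + rho - load t
     else if t = 0 \<and> j = 0 then 2 * rho * (real a + 1)
     else if t = a \<and> 2 \<le> j then rho * (real a + 1) else 0)"

lemma facet_weight_nonneg: "facet_weight i \<ge> 0"
proof -
  \<comment> \<open>The right-hand side is the weight of the hub of star 0.\<close>
  have "0 \<le> real a * (real b - 2) + (real b - 3)" using b3 by simp
  then have "2 * (real a + 1) \<le> real b + rho" by (simp add: rho_def algebra_simps)
  moreover have "(real b - 2) * (real a + 1) \<le> real b + rho" by (simp add: rho_def algebra_simps)
  ultimately have "load t \<le> real b + rho" for t
    using rho_bounds(3) by (simp add: load_def)
  then show ?thesis using rho_bounds(3) by (cases i) (simp add: facet_weight_def)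
qed

lemma facet_weight_orth:
  assumes "f \<in> deps"
  shows "(\<Sum>i\<in>idx. facet_weight i * f i) = 0"
proof -
  obtain \<alpha> \<beta> where f: "f = val \<alpha> \<beta>" and \<alpha>: "(\<Sum>t\<le>a. \<alpha> t) = 0"
    using assms by (auto simp: deps_def)
  define S where "S = (\<Sum>j<b. \<beta> j)"
  define M where "M = real a + 1"
  define R where "R = (\<Sum>j=3..<b. \<beta> j)"
  have S: "S = \<beta> 0 + \<beta> 1 + \<beta> 2 + R" unfolding S_def R_def by (rule sum_split3)
  \<comment> \<open>\<open>X\<close> and \<open>Y\<close> are the excess of stars 0 and
    \<open>a\<close> over the contribution common to all stars.\<close>
  define X where "X = M * (2 * S + rho * (\<beta> 0 + \<beta> 1))"
  define Y where "Y = M * ((real b - 2) * S + rho * (\<beta> 2 + R))"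
  have star: "(\<Sum>j<b. facet_weight (t, j) * val \<alpha> \<beta> (t, j)) + facet_weight (t, b) * val \<alpha> \<beta> (t, b)
      = rho * (real b + rho) * \<alpha> t - (real b + rho) * S
        + (if t = 0 then X else 0) + (if t = a then Y else 0)" for t
  proof -
    have hub: "facet_weight (t, b) * val \<alpha> \<beta> (t, b) = (real b + rho - load t) * (rho * \<alpha> t - S)"
      by (simp add: facet_weight_def val_hub S_def)
    consider "t = 0" | "t = a" "t \<noteq> 0" | "t \<noteq> 0" "t \<noteq> a" by blast
    then show ?thesis
    proof cases
      case 1
      have "(\<Sum>j<b. facet_weight (t, j) * val \<alpha> \<beta> (t, j)) = rho * M * (2 * \<alpha> 0 + \<beta> 0 + \<beta> 1)"
        unfolding sum_split3 using 1 a2 b3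
        by (simp add: facet_weight_def val_leaf leaf_def M_def field_simps)
      then show ?thesis using 1 a2 unfolding hub
        by (simp add: load_def X_def M_def algebra_simps)
    next
      case 2
      have "(\<Sum>j=3..<b. facet_weight (t, j) * val \<alpha> \<beta> (t, j)) = (\<Sum>j=3..<b. rho * M * (\<alpha> a + \<beta> j))"
        by (rule sum.cong) (use 2 ma in \<open>auto simp: facet_weight_def val_leaf leaf_def M_def\<close>)
      also have "\<dots> = rho * M * ((real b - 3) * \<alpha> a + R)"
        using b3 by (simp add: sum_distrib_left[symmetric] sum.distrib R_def)
      finally have "(\<Sum>j<b. facet_weight (t, j) * val \<alpha> \<beta> (t, j))
          = rho * M * ((real b - 2) * \<alpha> a + \<beta> 2 + R)"
        unfolding sum_split3 using 2 ma b3
        by (simp add: facet_weight_def val_leaf leaf_def M_def algebra_simps)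
      then show ?thesis using 2 unfolding hub
        by (simp add: load_def Y_def M_def algebra_simps)
    next
      case 3
      have "(\<Sum>j<b. facet_weight (t, j) * val \<alpha> \<beta> (t, j)) = 0"
        by (rule sum.neutral) (use 3 in \<open>auto simp: facet_weight_def\<close>)
      then show ?thesis using 3 unfolding hub by (simp add: load_def algebra_simps)
    qed
  qed
  have "(\<Sum>i\<in>idx. facet_weight i * f i)
      = (\<Sum>t\<le>a. (\<Sum>j<b. facet_weight (t, j) * val \<alpha> \<beta> (t, j)) + facet_weight (t, b) * val \<alpha> \<beta> (t, b))"
    unfolding f by (subst sum_idx) (auto simp: val_merged)
  also have "\<dots> = (\<Sum>t\<le>a. rho * (real b + rho) * \<alpha> t) - M * ((real b + rho) * S) + X + Y"
    unfolding star by (simp add: sum.distrib sum_subtractf M_def)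
  also have "(\<Sum>t\<le>a. rho * (real b + rho) * \<alpha> t) = 0"
    using \<alpha> by (simp add: sum_distrib_left[symmetric])
  also have "0 - M * ((real b + rho) * S) + X + Y = 0"
    unfolding X_def Y_def S by (simp add: algebra_simps)
  finally show ?thesis .
qed

lemma facet_weight_support: "card {i \<in> idx. facet_weight i \<noteq> 0} \<le> card bas"
proof -
  have "{i \<in> idx. facet_weight i \<noteq> 0} \<subseteq> insert (0, 0) ({a} \<times> {2..<b} \<union> {..a} \<times> {b})"
    by (auto simp: facet_weight_def idx_def split: if_splits)
  then have "card {i \<in> idx. facet_weight i \<noteq> 0} \<le> card (insert (0, 0) ({a} \<times> {2..<b} \<union> {..a} \<times> {b}))"
    by (rule card_mono[rotated]) auto
  also have "\<dots> \<le> Suc (card ({a} \<times> {2..<b} \<union> {..a} \<times> {b}))"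
    by (subst card_insert_if) auto
  also have "\<dots> \<le> Suc (card ({a} \<times> {2..<b}) + card ({..a} \<times> {b}))"
    using card_Un_le[of "{a} \<times> {2..<b}" "{..a} \<times> {b}"] by (simp only: Suc_le_mono)
  also have "\<dots> = card bas" using b3 by (simp add: card_bas)
  finally show ?thesis .
qed

lemma nonsimplicial_illuminated_polytope_exists:
  assumes "a * b = DIM('a::euclidean_space) + m"
  obtains P :: "'a::euclidean_space set"
  where "d_polytope P" "illuminated P" "f0 P = DIM('a) + 1 + (a + b)" "\<not> simplicial P"
proof -
  note result = that
  have card: "card idx = DIM('a) + 1 + card bas"
    using assms by (simp add: card_idx card_bas)
  \<comment> \<open>Star 1 differs from stars 0 and \<open>a\<close> because
    \<open>a \<ge> 2\<close>, so it carries no load.\<close>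
  have "facet_weight (1, b) \<noteq> 0" "(1, b) \<in> idx"
    using a2 b3 rho_bounds(3) by (auto simp: idx_def facet_weight_def load_def)
  then have nonzero: "\<exists>i\<in>idx. facet_weight i \<noteq> 0" by blast
  show thesis
  proof (rule nonsimplicial_illuminated_polytope[where p = facet_weight, OF card])
    show "f i = 0" if "f \<in> deps" "\<forall>j\<in>idx. j \<noteq> v \<longrightarrow> 0 \<le> f j" "i \<in> idx" for f v i
      using that by (rule deps_spanning)
    show thesis if "d_polytope P" "illuminated P" "f0 P = card idx" "\<not> simplicial P" for P :: "'a set"
      using that result[of P] card card_bas by simp
  qed (rule deps_diagonal facet_weight_orth facet_weight_nonneg nonzero facet_weight_support; assumption)+
qed

end

section \<open>Choice of the parameters\<close>

text \<open>\<open>k\<close> is the least number with \<open>4 * d \<le> k * k\<close>. Splitting it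
  as evenly as possible gives \<open>d \<le> a * b\<close>, and minimality bounds the surplus
  \<open>m\<close> below \<open>a\<close>.\<close>

lemma mani_parameters:
  fixes d :: nat
  assumes d: "6 \<le> d"
  obtains a b m where "2 \<le> a" "3 \<le> b" "m < a" "a * b = d + m" "mani_number d = d + 1 + (a + b)"
proof -
  define k where "k = nat \<lceil>2 * sqrt (real d)\<rceil>"
  have "sqrt (real d) > 0" using d by simp
  then have rk: "2 * sqrt (real d) \<le> real k" "real k < 2 * sqrt (real d) + 1" "1 \<le> k"
    unfolding k_def by linarith+
  have "(2 * sqrt (real d))\<^sup>2 \<le> (real k)\<^sup>2" using rk by (intro power_mono) auto
  then have "real (4 * d) \<le> real (k * k)" by (simp add: power2_eq_square)
  then have lo: "4 * d \<le> k * k" by (simp only: of_nat_le_iff)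
  have "(real k - 1)\<^sup>2 < (2 * sqrt (real d))\<^sup>2" using rk by (intro power_strict_mono) auto
  then have "real ((k - 1) * (k - 1)) < real (4 * d)" using rk(3) by (simp add: power2_eq_square)
  then have hi: "(k - 1) * (k - 1) < 4 * d" by (simp only: of_nat_less_iff)
  have k5: "5 \<le> k"
  proof (rule ccontr)
    assume "\<not> 5 \<le> k"
    then have "k * k \<le> 4 * 4" by (intro mult_le_mono) auto
    then show False using lo d by simp
  qed
  \<comment> \<open>This makes the second term of the minimum the relevant one;
    \<open>(d - 1) * (d - 1) > 4 * d\<close> holds from \<open>d = 6\<close> on.\<close>
  have kd: "k + 1 \<le> d"
  proof (rule ccontr)
    assume "\<not> k + 1 \<le> d"
    then have "(d - 1) * (d - 1) \<le> (k - 1) * (k - 1)" by (intro mult_le_mono) auto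
    then have lt: "(d - 1) * (d - 1) < 4 * d" using hi by simp
    obtain e where "d = 6 + e" using d le_Suc_ex by blast
    then show False using lt by (simp add: algebra_simps)
  qed
  define a where "a = k div 2"
  define b where "b = k - a"
  have "k = 2 * a \<and> b = a \<or> k = 2 * a + 1 \<and> b = a + 1" unfolding a_def b_def by linarith
  then have "d \<le> a * b \<and> a * b < d + a"
  proof
    assume k: "k = 2 * a \<and> b = a"
    then obtain c where c: "a = Suc c" using k5 by (cases a) auto
    show ?thesis using lo hi k by (simp add: c algebra_simps)
  next
    assume k: "k = 2 * a + 1 \<and> b = a + 1"
    show ?thesis using lo hi k by (simp add: algebra_simps)
  qed
  moreover have "2 \<le> a" "3 \<le> b" "a + b = k" using k5 unfolding a_def b_def by linarith+
  moreover have "mani_number d = d + 1 + k"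
    using kd unfolding mani_number_def k_def[symmetric] by simp
  ultimately show thesis using that[of a b "a * b - d"] by auto
qed

theorem theorem3p1:
  assumes "CARD('n::finite) \<ge> 6"
  shows "\<exists>P :: (real ^ 'n) set. mani_polytope P \<and> \<not> simplicial P"
proof -
  obtain a b m where p: "2 \<le> a" "3 \<le> b" "m < a" "a * b = CARD('n) + m"
    and mani: "mani_number CARD('n) = CARD('n) + 1 + (a + b)"
    using mani_parameters[OF assms] by blast
  interpret star_diagram a b m by unfold_locales (use p in auto)
  have "a * b = DIM(real ^ 'n) + m" using p(4) by simp
  then obtain P :: "(real ^ 'n) set" where "d_polytope P" "illuminated P"
    "f0 P = DIM(real ^ 'n) + 1 + (a + b)" "\<not> simplicial P"
    using nonsimplicial_illuminated_polytope_exists by blast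
  then show ?thesis using mani unfolding mani_polytope_def by auto
qed

end
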